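(* Let $\Delta\geq 4$ be an integer and let $G$ be a finite simple graph of maximum degree at most $\Delta$ and girth at least $5$. Then \[ \nu_{ur}(G) \geq \frac{n(G)-c(G)}{\Delta}. \]
   Context: All graphs are simple, finite and undirected. The girth of $G$ is the minimum length of a cycle in $G$ (infinite if $G$ has no cycle). A matching in $G$ is a set of pairwise non-adjacent edges. A matching $M$ in $G$ is uniquely restricted if no other matching in $G$ covers exactly the same set of vertices as $M$. $\nu_{ur}(G)$ denotes the maximum size of a uniquely restricted matching in $G$. $n(G)$ and $c(G)$ denote the number of vertices and the number of connected components of $G$, respectively. *)

theory Defs
  imports Complex_Main "HOL-Library.Extended_Nat" "Graph_Theory.Graph_Theory"
begin

text \<open>
  A finite simple undirected graph is a \<^locale>\<open>pair_graph\<close>: a finite vertex set together with a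
  symmetric irreflexive set of arcs. Every undirected edge corresponds to two opposite arcs,
  so the degree of a vertex is its out-degree.
\<close>

definition uedges :: "'a pair_pre_digraph \<Rightarrow> 'a set set" where
  "uedges G = {{u, v} | u v. (u, v) \<in> parcs G}"

text \<open>The empty graph is given maximum degree 0.\<close>

definition max_degree :: "'a pair_pre_digraph \<Rightarrow> nat" where
  "max_degree G = Max (insert 0 (out_degree (with_proj G) ` pverts G))"

text \<open>
  The directed notion of cycle also admits the closed walk that runs along an edge and
  back, which has length 2 and is not a cycle of the undirected graph. A closed walk of length
  at least 3 without repeated vertices uses no edge twice. The infimum of the empty set
  is \<open>\<infinity>\<close>.
\<close>

definition girth :: "'a pair_pre_digraph \<Rightarrow> enat" where
  "girth G = (INF p \<in> {p. pre_digraph.cycle (with_proj G) p \<and> 3 \<le> length p}. enat (length p))"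

definition matching :: "'a pair_pre_digraph \<Rightarrow> 'a set set \<Rightarrow> bool" where
  "matching G M \<longleftrightarrow> M \<subseteq> uedges G \<and> pairwise disjnt M"

definition uniquely_restricted :: "'a pair_pre_digraph \<Rightarrow> 'a set set \<Rightarrow> bool" where
  "uniquely_restricted G M \<longleftrightarrow>
     matching G M \<and> (\<forall>N. matching G N \<and> \<Union>N = \<Union>M \<longrightarrow> N = M)"

definition nu_ur :: "'a pair_pre_digraph \<Rightarrow> nat" where
  "nu_ur G = Max (card ` {M. uniquely_restricted G M})"

text \<open>
  As arcs are symmetric, reachability is an undirected notion, and the strongly connected
  components are the connected components.
\<close>

definition num_components :: "'a pair_pre_digraph \<Rightarrow> nat" where
  "num_components G = card (pre_digraph.sccs (with_proj G))"

end

theory Submission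
  imports Defs
begin

text \<open>
  Choosing an edge \<open>uv\<close> and deleting the closed neighbourhood of \<open>u\<close> extends a uniquely restricted
  matching of the rest by \<open>uv\<close>. Call \<open>n - \<Delta> \<nu>\<close> the deficiency. It is shown to be at most the number
  of components that are tight trees, i.e. trees in which one colour class consists of vertices of
  degree \<open>\<Delta>\<close>; a nontrivial tight tree has a vertex with at least \<open>\<Delta> - 1\<close> leaves attached.

  A minimal counterexample \<open>H\<close> is connected, and deleting \<open>N[u]\<close> must create tight components
  if \<open>deg u < \<Delta>\<close>. If \<open>u\<close> is a leaf, \<open>H\<close> is itself tight, so all degrees are at least 2; then the
  leaves of a tight component have neighbours in \<open>N(u)\<close>, distinct since there is no 4-cycle,
  and hence \<open>deg u \<ge> \<Delta> - 1\<close>. Now take a minimal nonempty \<open>X \<subseteq> H\<close> of nonnegative deficiency with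
  minimum degree at least \<open>\<Delta> - 1\<close>. Deleting \<open>N[w]\<close> for a suitable \<open>w\<close> keeps the deficiency
  nonnegative, so by minimality some \<open>x\<close> has degree at most \<open>\<Delta> - 2\<close> in the rest, where all degrees
  are still at least \<open>\<Delta> - 2 \<ge> 2\<close>. Deleting \<open>N[x]\<close> makes the deficiency positive and so leaves a
  tight component, whose leaves have \<open>\<Delta> - 1\<close> distinct neighbours in \<open>N(x)\<close>, a contradiction.
\<close>

section \<open>Degrees, neighbourhoods and short cycles\<close>

lemma cycle_length_ge_girth:
  assumes "pre_digraph.cycle (with_proj G) p" "3 \<le> length p" "5 \<le> girth G"
  shows "5 \<le> length p"
proof -
  have "girth G \<le> enat (length p)"
    unfolding girth_def using assms by (intro INF_lower) auto
  with assms(3) have "(5::enat) \<le> enat (length p)" by (rule order_trans)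
  then show ?thesis by (simp add: numeral_eq_enat)
qed

locale girth_five_graph = pair_graph G for G :: "'a pair_pre_digraph" +
  fixes \<Delta> :: nat
  assumes four_le: "4 \<le> \<Delta>"
    and max_degree_le: "max_degree G \<le> \<Delta>"
    and girth_ge: "5 \<le> girth G"
begin

text \<open>The vertex \<open>u\<close> may lie outside \<open>X\<close>, so the same notation
  serves for degrees in induced subgraphs and for the edges from a vertex \<open>v\<close> to a
  component \<open>A\<close>.\<close>

definition nb :: "'a set \<Rightarrow> 'a \<Rightarrow> 'a set" where
  "nb X u = {w \<in> X. (u, w) \<in> parcs G}"

lemma arc_sym: "(u, v) \<in> parcs G \<Longrightarrow> (v, u) \<in> parcs G"
  using pair_sym_arcs by (auto simp: symmetric_def dest: symD)

lemma arc_irrefl: "(u, u) \<notin> parcs G"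
  using pair_no_loops by fastforce

lemma nb_subset: "nb X u \<subseteq> X"
  by (auto simp: nb_def)

lemma not_in_nb_self: "u \<notin> nb X u"
  by (simp add: nb_def arc_irrefl)

lemma finite_nb: "finite (nb X u)"
  by (rule finite_subset[OF _ pair_finite_verts]) (auto simp: nb_def dest: in_arcsD2)

lemma nb_mono: "X \<subseteq> Y \<Longrightarrow> nb X u \<subseteq> nb Y u"
  by (auto simp: nb_def)

lemma card_nb_le: "card (nb X u) \<le> \<Delta>"
proof (cases "u \<in> pverts G")
  case True
  have "card (nb X u) \<le> card (nb UNIV u)"
    by (intro card_mono finite_nb nb_mono) simp
  also have "\<dots> \<le> card (out_arcs (with_proj G) u)"
  proof (rule surj_card_le)
    show "finite (out_arcs (with_proj G) u)"
      by (rule finite_subset[OF _ pair_finite_arcs]) (auto simp: out_arcs_def)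
    show "nb UNIV u \<subseteq> snd ` out_arcs (with_proj G) u"
      by (force simp: nb_def out_arcs_def)
  qed
  also have "\<dots> = out_degree (with_proj G) u" by (simp add: out_degree_def)
  also have "\<dots> \<le> max_degree G"
    unfolding max_degree_def using True pair_finite_verts by (intro Max_ge) auto
  finally show ?thesis using max_degree_le by simp
next
  case False
  then have "nb X u = {}" by (auto simp: nb_def dest: in_arcsD1)
  then show ?thesis by simp
qed

lemma triangle_free:
  assumes "(a, b) \<in> parcs G" "(b, c) \<in> parcs G"
  shows "(c, a) \<notin> parcs G"
proof
  assume "(c, a) \<in> parcs G"
  let ?p = "[(a, b), (b, c), (c, a)]"
  have "cycle ?p"
    unfolding cycle_def using assms \<open>(c, a) \<in> parcs G\<close> arc_irrefl
    by (intro exI[of _ a]) (auto simp: awalk_def dest: in_arcsD1)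
  then show False using cycle_length_ge_girth[of G ?p] girth_ge by simp
qed

lemma common_nb_unique:
  assumes "(a, b) \<in> parcs G" "(c, b) \<in> parcs G" "(a, d) \<in> parcs G" "(c, d) \<in> parcs G" "a \<noteq> c"
  shows "b = d"
proof (rule ccontr)
  assume "b \<noteq> d"
  let ?p = "[(a, b), (b, c), (c, d), (d, a)]"
  have "cycle ?p"
    unfolding cycle_def using assms \<open>b \<noteq> d\<close> arc_irrefl
    by (intro exI[of _ a]) (auto simp: awalk_def dest: in_arcsD1 intro: arc_sym)
  then show False using cycle_length_ge_girth[of G ?p] girth_ge by simp
qed

section \<open>Unions of components, and uniquely restricted matchings in induced subgraphs\<close>

definition closed_in :: "'a set \<Rightarrow> 'a set \<Rightarrow> bool" where
  "closed_in X C \<longleftrightarrow> C \<subseteq> X \<and> (\<forall>x\<in>C. nb X x \<subseteq> C)"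

lemma nb_closed_in: "closed_in X C \<Longrightarrow> x \<in> C \<Longrightarrow> nb X x = nb C x"
  by (auto simp: closed_in_def nb_def)

lemma closed_in_trans: "closed_in X Y \<Longrightarrow> closed_in Y C \<Longrightarrow> closed_in X C"
  unfolding closed_in_def nb_def by blast

lemma closed_in_Diff: "closed_in X C \<Longrightarrow> closed_in X (X - C)"
  by (auto simp: closed_in_def nb_def dest: arc_sym)

text \<open>Uniqueness is tested in all of \<open>G\<close>, but a competing matching covers the
  same vertices and so also lies inside \<open>X\<close>: this is the parameter of the subgraph
  induced by \<open>X\<close>.\<close>

definition nu :: "'a set \<Rightarrow> nat" where
  "nu X = Max (card ` {M. uniquely_restricted G M \<and> \<Union>M \<subseteq> X})"

lemma finite_uedges: "finite (uedges G)"
proof -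
  have "uedges G = (\<lambda>(u, v). {u, v}) ` parcs G" by (auto simp: uedges_def)
  then show ?thesis using pair_finite_arcs by simp
qed

lemma finite_uniquely_restricted: "finite {M. uniquely_restricted G M \<and> P M}"
  by (rule finite_subset[of _ "Pow (uedges G)"])
    (auto simp: uniquely_restricted_def matching_def finite_uedges)

lemma matching_finite: "matching G M \<Longrightarrow> finite M"
  using finite_uedges by (auto simp: matching_def intro: finite_subset)

lemma uniquely_restricted_empty: "uniquely_restricted G {}"
  by (auto simp: uniquely_restricted_def matching_def uedges_def)

lemma nu_ge: "uniquely_restricted G M \<Longrightarrow> \<Union>M \<subseteq> X \<Longrightarrow> card M \<le> nu X"
  unfolding nu_def using finite_uniquely_restricted[of "\<lambda>M. \<Union>M \<subseteq> X"] by (intro Max_ge) auto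

lemma nu_attained:
  obtains M where "uniquely_restricted G M" "\<Union>M \<subseteq> X" "card M = nu X"
proof -
  have "nu X \<in> card ` {M. uniquely_restricted G M \<and> \<Union>M \<subseteq> X}"
    unfolding nu_def using uniquely_restricted_empty
    by (intro Max_in finite_imageI finite_uniquely_restricted) auto
  then show ?thesis using that by auto
qed

lemma nu_le_nu_ur: "nu X \<le> nu_ur G"
proof -
  obtain M where M: "uniquely_restricted G M" "card M = nu X" by (rule nu_attained)
  have "card M \<le> nu_ur G"
    unfolding nu_ur_def using M(1) finite_uniquely_restricted[of "\<lambda>_. True"] by (intro Max_ge) auto
  then show ?thesis using M(2) by simp
qed

text \<open>All other covered vertices lie outside the closed neighbourhood of \<open>u\<close>, so
  a competing matching must match \<open>u\<close> to \<open>v\<close>; without that edge it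
  competes with \<open>M\<close>.\<close>

lemma uniquely_restricted_insert:
  assumes "uniquely_restricted G M" "\<Union>M \<subseteq> X - insert u (nb X u)" "u \<in> X" "v \<in> nb X u"
  shows "uniquely_restricted G (insert {u, v} M)"
  unfolding uniquely_restricted_def
proof (intro conjI allI impI)
  have uv: "(u, v) \<in> parcs G" using assms(4) by (simp add: nb_def)
  have uvM: "u \<notin> \<Union>M" "v \<notin> \<Union>M" using assms(2,4) by auto
  have M: "M \<subseteq> uedges G" "pairwise disjnt M"
    using assms(1) by (auto simp: uniquely_restricted_def matching_def)
  have "disjnt {u, v} e" if "e \<in> M" for e
    using uvM that by (auto simp: disjnt_def)
  then show "matching G (insert {u, v} M)"
    using M uv by (auto simp: matching_def uedges_def pairwise_insert disjnt_sym)
  fix N assume N: "matching G N \<and> \<Union>N = \<Union>(insert {u, v} M)"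
  then have "u \<in> \<Union>N" by auto
  then obtain e where e: "e \<in> N" "u \<in> e" by blast
  then have "e \<in> uedges G" using N by (auto simp: matching_def)
  then obtain y where y: "e = {u, y}" "(u, y) \<in> parcs G"
    using e(2) unfolding uedges_def by (auto dest: arc_sym)
  have "y \<in> {u, v} \<union> \<Union>M" using N e(1) y(1) by auto
  moreover have "y \<noteq> u" using y(2) arc_irrefl by auto
  moreover have "y \<notin> \<Union>M"
  proof
    assume "y \<in> \<Union>M"
    then have "y \<in> X - nb X u" using assms(2) by auto
    then show False using y(2) by (simp add: nb_def)
  qed
  ultimately have eq: "e = {u, v}" using y(1) by auto
  have dis: "f \<inter> {u, v} = {}" if "f \<in> N" "f \<noteq> e" for f
    using N that e(1) eq by (auto simp: matching_def pairwise_def disjnt_def)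
  have "matching G (N - {e})"
    using N by (auto simp: matching_def intro: pairwise_subset)
  moreover have "\<Union>(N - {e}) = \<Union>M"
  proof
    show "\<Union>(N - {e}) \<subseteq> \<Union>M" using N dis by fastforce
    show "\<Union>M \<subseteq> \<Union>(N - {e})"
    proof
      fix x assume x: "x \<in> \<Union>M"
      then have "x \<in> \<Union>N" using N by auto
      then obtain f where f: "f \<in> N" "x \<in> f" by blast
      moreover have "f \<noteq> e" using eq x f(2) uvM by auto
      ultimately show "x \<in> \<Union>(N - {e})" by blast
    qed
  qed
  ultimately have "N - {e} = M" using assms(1) by (auto simp: uniquely_restricted_def)
  then show "N = insert {u, v} M" using e(1) eq by auto
qed

lemma nu_remove_nbhd:
  assumes "u \<in> X" "nb X u \<noteq> {}"
  shows "Suc (nu (X - insert u (nb X u))) \<le> nu X"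
proof -
  obtain v where v: "v \<in> nb X u" using assms(2) by blast
  obtain M where M: "uniquely_restricted G M" "\<Union>M \<subseteq> X - insert u (nb X u)"
    "card M = nu (X - insert u (nb X u))" by (rule nu_attained)
  have "finite M" using M(1) matching_finite by (auto simp: uniquely_restricted_def)
  moreover have "{u, v} \<notin> M" using M(2) by auto
  moreover have "card (insert {u, v} M) \<le> nu X"
    using uniquely_restricted_insert[OF M(1,2) assms(1) v] M(2) assms(1) v nb_subset[of X u]
    by (intro nu_ge) auto
  ultimately show ?thesis using M(3) by simp
qed

text \<open>No edge inside \<open>X\<close> leaves \<open>C\<close>, so a competing matching splits
  into one competing with \<open>M\<close> and one competing with \<open>M'\<close>.\<close>

lemma uniquely_restricted_Un:
  assumes M: "uniquely_restricted G M" "\<Union>M \<subseteq> C" and M': "uniquely_restricted G M'" "\<Union>M' \<subseteq> X - C"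
    and C: "closed_in X C"
  shows "uniquely_restricted G (M \<union> M')"
  unfolding uniquely_restricted_def
proof (intro conjI allI impI)
  have mm: "matching G M" "matching G M'"
    using M(1) M'(1) by (auto simp: uniquely_restricted_def)
  have "disjnt e f" if "e \<in> M" "f \<in> M'" for e f
    using that M(2) M'(2) by (fastforce simp: disjnt_def)
  then show "matching G (M \<union> M')"
    using mm by (auto simp: matching_def pairwise_def disjnt_sym)
  fix N assume N: "matching G N \<and> \<Union>N = \<Union>(M \<union> M')"
  have sides: "e \<subseteq> C \<or> e \<subseteq> X - C" if "e \<in> N" for e
  proof -
    have "e \<in> uedges G" using N that by (auto simp: matching_def)
    then obtain a b where ab: "e = {a, b}" "(a, b) \<in> parcs G" by (auto simp: uedges_def)
    have "C \<subseteq> X" using C by (simp add: closed_in_def)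
    have "e \<subseteq> \<Union>(M \<union> M')" using N that by auto
    also have "\<dots> \<subseteq> X" using M(2) M'(2) \<open>C \<subseteq> X\<close> by blast
    finally have "a \<in> X" "b \<in> X" using ab by auto
    then show ?thesis
      using C ab arc_sym[OF ab(2)] by (auto simp: closed_in_def nb_def)
  qed
  define N1 where "N1 = {e \<in> N. e \<subseteq> C}"
  define N2 where "N2 = {e \<in> N. e \<subseteq> X - C}"
  have U: "N = N1 \<union> N2" using sides by (auto simp: N1_def N2_def)
  have UN: "\<Union>N1 \<union> \<Union>N2 = \<Union>M \<union> \<Union>M'" using N U by auto
  have "\<Union>N1 \<subseteq> C" "\<Union>N2 \<subseteq> X - C" by (auto simp: N1_def N2_def)
  then have "\<Union>N1 = \<Union>M" "\<Union>N2 = \<Union>M'" using UN M(2) M'(2) by blast+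
  moreover have "matching G N1" "matching G N2"
    using N by (auto simp: N1_def N2_def matching_def intro: pairwise_subset)
  ultimately have "N1 = M" "N2 = M'"
    using M(1) M'(1) by (auto simp: uniquely_restricted_def)
  then show "N = M \<union> M'" using U by simp
qed

lemma nu_closed_in:
  assumes "closed_in X C"
  shows "nu C + nu (X - C) \<le> nu X"
proof -
  obtain M where M: "uniquely_restricted G M" "\<Union>M \<subseteq> C" "card M = nu C" by (rule nu_attained)
  obtain M' where M': "uniquely_restricted G M'" "\<Union>M' \<subseteq> X - C" "card M' = nu (X - C)"
    by (rule nu_attained)
  have mm: "matching G M" "matching G M'"
    using M(1) M'(1) by (auto simp: uniquely_restricted_def)
  have "e \<noteq> {}" if "e \<in> M" for e using mm(1) that by (auto simp: matching_def uedges_def)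
  then have "M \<inter> M' = {}" using M(2) M'(2) by fastforce
  then have "card (M \<union> M') = nu C + nu (X - C)"
    using mm matching_finite M(3) M'(3) by (simp add: card_Un_disjoint)
  moreover have "card (M \<union> M') \<le> nu X"
    using uniquely_restricted_Un[OF M(1,2) M'(1,2) assms] M(2) M'(2) assms
    by (intro nu_ge) (auto simp: closed_in_def)
  ultimately show ?thesis by simp
qed

section \<open>Tight trees and their leaves\<close>

text \<open>
  In an induced subgraph, the maximum degree bound forces the new vertex \<open>v\<close> to be attached to
  vertices of the colour class of unrestricted degree, so these are exactly the tight trees.
\<close>

inductive tight :: "'a set \<Rightarrow> bool" where
  single: "tight {z}"
| join: "\<lbrakk>card F = \<Delta>; \<forall>A\<in>F. tight A; \<forall>A\<in>F. closed_in (\<Union>F) A; \<forall>A\<in>F. card (nb A v) = 1;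
    v \<notin> \<Union>F\<rbrakk> \<Longrightarrow> tight (insert v (\<Union>F))"

lemma tight_nonempty: "tight C \<Longrightarrow> C \<noteq> {}"
  by (cases rule: tight.cases) auto

lemma tight_finite: "tight C \<Longrightarrow> finite C"
proof (induction rule: tight.induct)
  case (join F v)
  have "finite F" using join.hyps four_le by (intro card_ge_0_finite) simp
  then show ?case using join.IH by auto
qed simp

text \<open>Connectedness of \<open>C\<close>, phrased for an arbitrary \<open>D\<close> closed
  under neighbours within \<open>C\<close>. In a join, \<open>D\<close> absorbs any member that it
  meets, passes through the attached vertex to \<open>v\<close>, and from there reaches all
  members.\<close>

lemma tight_connected:
  assumes "tight C" "C \<inter> D \<noteq> {}" "\<And>x. x \<in> C \<inter> D \<Longrightarrow> nb C x \<subseteq> D"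
  shows "C \<subseteq> D"
  using assms
proof (induction rule: tight.induct)
  case (single z)
  then show ?case by auto
next
  case (join F v)
  let ?C = "insert v (\<Union>F)"
  have IH: "A \<subseteq> D" if "A \<in> F" "A \<inter> D \<noteq> {}" for A
  proof -
    have "nb A x \<subseteq> D" if "x \<in> A \<inter> D" for x
      using join.prems(2)[of x] that \<open>A \<in> F\<close> nb_mono[of A ?C x] by blast
    then show ?thesis using join.IH that by blast
  qed
  have ex: "\<exists>p. p \<in> A \<and> (v, p) \<in> parcs G" if "A \<in> F" for A
  proof -
    have "card (nb A v) = 1" using join that by blast
    then have "nb A v \<noteq> {}" by auto
    then show ?thesis by (auto simp: nb_def)
  qed
  have "v \<in> D"
  proof (rule ccontr)
    assume "v \<notin> D"
    then obtain A where A: "A \<in> F" "A \<inter> D \<noteq> {}" using join.prems(1) by blast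
    then obtain p where "p \<in> A" "(v, p) \<in> parcs G" using ex by blast
    moreover have "p \<in> D" using IH[OF A] \<open>p \<in> A\<close> by blast
    ultimately show False
      using join.prems(2)[of p] A(1) \<open>v \<notin> D\<close> arc_sym by (auto simp: nb_def)
  qed
  have "A \<subseteq> D" if A: "A \<in> F" for A
  proof -
    obtain p where "p \<in> A" "(v, p) \<in> parcs G" using ex A by blast
    then have "p \<in> D" using join.prems(2)[of v] \<open>v \<in> D\<close> A by (auto simp: nb_def)
    then show ?thesis using IH A \<open>p \<in> A\<close> by blast
  qed
  then show ?case using \<open>v \<in> D\<close> by blast
qed

lemma tight_subset_closed_in:
  assumes "tight A" "A \<subseteq> X" "closed_in X B" "A \<inter> B \<noteq> {}"
  shows "A \<subseteq> B"
proof (rule tight_connected[OF assms(1,4)])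
  fix x assume "x \<in> A \<inter> B"
  then show "nb A x \<subseteq> B"
    using nb_mono[OF assms(2), of x] assms(3) unfolding closed_in_def by blast
qed

lemma tight_closed_in_disjoint:
  assumes "tight A" "tight B" "closed_in X A" "closed_in X B" "A \<inter> B \<noteq> {}"
  shows "A = B"
  using tight_subset_closed_in[of A X B] tight_subset_closed_in[of B X A] assms
  unfolding closed_in_def by blast

text \<open>
  In a join, a vertex of a member other than the one attached to the new vertex keeps its
  neighbourhood; excluding one prescribed vertex \<open>a\<close> is what lets the induction go through.
\<close>

lemma tight_leaves:
  assumes "tight C" "\<nexists>z. C = {z}"
  shows "\<exists>b L. L \<subseteq> C \<and> a \<notin> L \<and> \<Delta> - 1 \<le> card L \<and> (\<forall>l\<in>L. nb C l = {b})"
  using assms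
proof (induction arbitrary: a rule: tight.induct)
  case (single z)
  then show ?case by auto
next
  case (join F v)
  let ?C = "insert v (\<Union>F)"
  have F: "card F = \<Delta>" "\<And>A. A \<in> F \<Longrightarrow> tight A" "\<And>A. A \<in> F \<Longrightarrow> closed_in (\<Union>F) A"
    "\<And>A. A \<in> F \<Longrightarrow> card (nb A v) = 1" "v \<notin> \<Union>F"
    using join by auto
  have "finite F" using F(1) four_le by (intro card_ge_0_finite) simp
  have disj: "A = B" if "A \<in> F" "B \<in> F" "x \<in> A" "x \<in> B" for A B x
    using tight_closed_in_disjoint[of A B "\<Union>F"] F(2,3) that by blast
  have nbC: "nb ?C l = nb A l \<union> nb {v} l" if "A \<in> F" "l \<in> A" for A l
    using nb_closed_in[OF F(3)] that by (auto simp: nb_def)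
  show ?case
  proof (cases "\<exists>A\<in>F. a \<notin> A \<and> (\<nexists>z. A = {z})")
    case True
    then obtain A where A: "A \<in> F" "a \<notin> A" "\<nexists>z. A = {z}" by blast
    obtain p where p: "nb A v = {p}" using F(4)[OF A(1)] card_1_singletonE by blast
    \<comment> \<open>Excluding \<open>p\<close>, the vertex of \<open>A\<close> attached to
      \<open>v\<close>, keeps the leaves found in \<open>A\<close> leaves of the join; they avoid
      \<open>a\<close> because \<open>A\<close> does.\<close>
    obtain b L where L: "L \<subseteq> A" "p \<notin> L" "\<Delta> - 1 \<le> card L" "\<forall>l\<in>L. nb A l = {b}"
      using join.IH A(1,3) by metis
    have "nb ?C l = {b}" if "l \<in> L" for l
    proof -
      have "l \<in> A" "l \<noteq> p" using L that by auto
      then have "(v, l) \<notin> parcs G" using p by (auto simp: nb_def)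
      then have "nb {v} l = {}" by (auto simp: nb_def dest: arc_sym)
      then show ?thesis using nbC[OF A(1) \<open>l \<in> A\<close>] L(4) that by simp
    qed
    moreover have "L \<subseteq> ?C" "a \<notin> L" using L(1) A by auto
    ultimately show ?thesis using L(3) by blast
  next
    case False
    \<comment> \<open>Now every member avoiding \<open>a\<close> is a single vertex. At most one of
      the \<Delta> disjoint members contains \<open>a\<close>, so at least \<Delta> - 1 leaves hang
      on \<open>v\<close>.\<close>
    define L where "L = {z. {z} \<in> F \<and> z \<noteq> a}"
    have Lsub: "L \<subseteq> \<Union>F" by (auto simp: L_def)
    have "finite (\<Union>F)" using \<open>finite F\<close> F(2) tight_finite by blast
    then have finL: "finite L" using Lsub finite_subset by blast
    have "card {A \<in> F. a \<in> A} \<le> 1"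
      using disj \<open>finite F\<close> by (intro card_le_Suc0_iff_eq[THEN iffD2, simplified One_nat_def[symmetric]]) auto
    moreover have "F = {A \<in> F. a \<in> A} \<union> {A \<in> F. a \<notin> A}" by auto
    then have "card F \<le> card {A \<in> F. a \<in> A} + card {A \<in> F. a \<notin> A}"
      using card_Un_le by metis
    moreover have "card {A \<in> F. a \<notin> A} \<le> card L"
      using False finL by (intro surj_card_le[of L _ "\<lambda>z. {z}"]) (auto simp: L_def)
    ultimately have "\<Delta> - 1 \<le> card L" using F(1) by simp
    moreover have "nb ?C l = {v}" if "l \<in> L" for l
    proof -
      have lF: "{l} \<in> F" using that by (simp add: L_def)
      have "card (nb {l} v) = 1" using F(4) lF by blast
      then have "nb {l} v \<noteq> {}" by auto
      then have "(l, v) \<in> parcs G" using arc_sym by (auto simp: nb_def)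
      then show ?thesis using nbC[OF lF] by (auto simp: nb_def arc_irrefl)
    qed
    ultimately show ?thesis using Lsub by (intro exI[of _ v] exI[of _ L]) (auto simp: L_def)
  qed
qed

section \<open>Tight components and the deletion of closed neighbourhoods\<close>

definition tight_comps :: "'a set \<Rightarrow> 'a set set" where
  "tight_comps X = {C. tight C \<and> closed_in X C}"

lemma finite_tight_comps: "finite X \<Longrightarrow> finite (tight_comps X)"
  by (rule finite_subset[of _ "Pow X"]) (auto simp: tight_comps_def closed_in_def)

lemma tight_comps_disjoint:
  "A \<in> tight_comps X \<Longrightarrow> B \<in> tight_comps X \<Longrightarrow> A \<inter> B \<noteq> {} \<Longrightarrow> A = B"
  using tight_closed_in_disjoint by (auto simp: tight_comps_def)

text \<open>Two alternatives for case analysis, the first for one-vertex trees. Both speak of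
  \<open>X\<close> itself, as a component keeps its neighbourhoods there.\<close>

lemma tight_comp_low_degree:
  assumes "C \<in> tight_comps X"
  obtains z where "z \<in> X" "nb X z = {}"
  | b L where "L \<subseteq> X" "\<Delta> - 1 \<le> card L" "\<And>l. l \<in> L \<Longrightarrow> nb X l = {b}"
proof (cases "\<exists>z. C = {z}")
  case True
  then obtain z where "C = {z}" by blast
  then have "z \<in> X" "nb X z = {}"
    using assms arc_irrefl by (auto simp: tight_comps_def closed_in_def nb_def)
  then show ?thesis by (rule that)
next
  case False
  then obtain b L where L: "L \<subseteq> C" "\<Delta> - 1 \<le> card L" "\<forall>l\<in>L. nb C l = {b}"
    \<comment> \<open>No particular vertex has to be avoided, so \<open>undefined\<close> stands in
      for the excluded one.\<close>
    using tight_leaves[of C undefined] assms by (auto simp: tight_comps_def)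
  have C: "closed_in X C" using assms by (simp add: tight_comps_def)
  then have "L \<subseteq> X" using L(1) by (auto simp: closed_in_def)
  moreover have "nb X l = {b}" if "l \<in> L" for l
    using nb_closed_in[OF C] L(1,3) that by auto
  ultimately show ?thesis using L(2) that(2) by blast
qed

abbreviation rest :: "'a set \<Rightarrow> 'a \<Rightarrow> 'a set" where
  "rest X u \<equiv> X - insert u (nb X u)"

text \<open>The vertex \<open>y\<close> loses only its common neighbours with \<open>u\<close>, and
  two of these would close a 4-cycle.\<close>

lemma card_nb_rest:
  assumes "y \<in> rest X u"
  shows "card (nb X y) \<le> Suc (card (nb (rest X u) y))"
proof -
  have "(y, u) \<notin> parcs G" using assms by (auto simp: nb_def dest: arc_sym)
  then have "nb X y \<subseteq> nb (rest X u) y \<union> (nb X y \<inter> nb X u)" by (auto simp: nb_def)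
  then have "card (nb X y) \<le> card (nb (rest X u) y \<union> (nb X y \<inter> nb X u))"
    by (intro card_mono) (auto simp: finite_nb)
  also have "\<dots> \<le> card (nb (rest X u) y) + card (nb X y \<inter> nb X u)" by (rule card_Un_le)
  also have "card (nb X y \<inter> nb X u) \<le> 1"
  proof -
    have "y \<noteq> u" using assms by auto
    then have "\<forall>b\<in>nb X y \<inter> nb X u. \<forall>d\<in>nb X y \<inter> nb X u. b = d"
      using common_nb_unique[of y _ u] by (auto simp: nb_def)
    then show ?thesis using card_le_Suc0_iff_eq[of "nb X y \<inter> nb X u"] finite_nb by simp
  qed
  finally show ?thesis by simp
qed

text \<open>A leaf left by the deletion had degree at least 2 before, so it lost a neighbour to
  \<open>nb X x\<close>. The bound serves both to raise the degrees in a minimal counterexample and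
  for the final contradiction.\<close>

lemma card_nb_ge_if_tight_comp:
  assumes "\<And>y. y \<in> rest X x \<Longrightarrow> 2 \<le> card (nb X y)"
    and "tight_comps (rest X x) \<noteq> {}"
  shows "\<Delta> - 1 \<le> card (nb X x)"
proof -
  obtain C where "C \<in> tight_comps (rest X x)" using assms(2) by blast
  then show ?thesis
  proof (cases rule: tight_comp_low_degree)
    case (1 z)
    then show ?thesis using card_nb_rest[of z X x] assms(1)[of z] by simp
  next
    case (2 b L)
    have "\<exists>q. q \<in> nb X l \<and> q \<in> nb X x" if l: "l \<in> L" for l
    proof (rule ccontr)
      assume no: "\<nexists>q. q \<in> nb X l \<and> q \<in> nb X x"
      have lr: "l \<in> rest X x" using l 2(1) by auto
      then have "x \<notin> nb X l" by (auto simp: nb_def dest: arc_sym)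
      then have "nb X l \<subseteq> nb (rest X x) l" using no by (auto simp: nb_def)
      then have "nb X l \<subseteq> {b}" using 2(3)[OF l] by simp
      then have "card (nb X l) \<le> 1" using card_mono[of "{b}" "nb X l"] by simp
      then show False using assms(1)[OF lr] by simp
    qed
    then obtain q where q: "\<And>l. l \<in> L \<Longrightarrow> q l \<in> nb X l" "\<And>l. l \<in> L \<Longrightarrow> q l \<in> nb X x" by metis
    \<comment> \<open>Two leaves with the same lost neighbour also share \<open>b\<close>. Without a
      4-cycle the two shared vertices coincide, but \<open>b\<close> survives the deletion.\<close>
    have "inj_on q L"
    proof (rule inj_onI, rule ccontr)
      fix l m assume lm: "l \<in> L" "m \<in> L" "q l = q m" "l \<noteq> m"
      have b: "b \<in> nb (rest X x) l" "b \<in> nb (rest X x) m" using 2(3) lm by auto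
      have "q l = b"
        using common_nb_unique[of l "q l" m b] lm q(1)[of l] q(1)[of m] b by (auto simp: nb_def)
      moreover have "b \<notin> nb X x" using b(1) by (auto simp: nb_def)
      ultimately show False using q(2)[OF lm(1)] by simp
    qed
    then have "card L \<le> card (nb X x)"
      using q(2) finite_nb by (intro card_inj_on_le[of q]) auto
    then show ?thesis using 2(2) by simp
  qed
qed

section \<open>Deficiency, and the tight trees forced by a leaf\<close>

definition deficiency :: "'a set \<Rightarrow> int" where
  "deficiency X = int (card X) - int \<Delta> * int (nu X)"

text \<open>The deletion removes \<open>card (nb X u) + 1\<close> vertices and lowers
  \<open>nu\<close> by at least one, which counts \<Delta>.\<close>

lemma deficiency_rest:
  assumes "finite X" "u \<in> X" "nb X u \<noteq> {}"
  shows "deficiency X + int \<Delta> \<le> int (card (nb X u)) + 1 + deficiency (rest X u)"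
proof -
  have "card X = card (rest X u) + card (insert u (nb X u))"
    using assms nb_subset[of X u]
    by (metis card_Diff_subset card_mono finite_subset insert_subset le_add_diff_inverse2)
  also have "card (insert u (nb X u)) = Suc (card (nb X u))"
    by (simp add: finite_nb not_in_nb_self)
  finally have "card X = card (rest X u) + Suc (card (nb X u))" .
  moreover have "int \<Delta> * int (Suc (nu (rest X u))) \<le> int \<Delta> * int (nu X)"
    using nu_remove_nbhd[OF assms(2,3)] by (intro mult_left_mono) auto
  ultimately show ?thesis by (simp add: deficiency_def algebra_simps)
qed

lemma deficiency_closed_in:
  assumes "finite X" "closed_in X C"
  shows "deficiency X \<le> deficiency C + deficiency (X - C)"
proof -
  have "card X = card C + card (X - C)"
    using assms by (metis closed_in_def card_Diff_subset card_mono finite_subset le_add_diff_inverse)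
  moreover have "int \<Delta> * int (nu C + nu (X - C)) \<le> int \<Delta> * int (nu X)"
    using nu_closed_in[OF assms(2)] by (intro mult_left_mono) auto
  ultimately show ?thesis by (simp add: deficiency_def algebra_simps)
qed

lemma card_tight_comps_closed_in:
  assumes "finite X" "closed_in X C"
  shows "card (tight_comps C) + card (tight_comps (X - C)) \<le> card (tight_comps X)"
proof -
  have fin: "finite C" using assms by (auto simp: closed_in_def intro: finite_subset)
  have "tight_comps C \<inter> tight_comps (X - C) = {}"
    using tight_nonempty by (fastforce simp: tight_comps_def closed_in_def)
  then have "card (tight_comps C) + card (tight_comps (X - C)) = card (tight_comps C \<union> tight_comps (X - C))"
    using fin assms(1) by (simp add: card_Un_disjoint finite_tight_comps)
  also have "\<dots> \<le> card (tight_comps X)"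
  proof (rule card_mono)
    show "finite (tight_comps X)" using assms(1) by (rule finite_tight_comps)
    show "tight_comps C \<union> tight_comps (X - C) \<subseteq> tight_comps X"
      using closed_in_trans[OF assms(2)] closed_in_trans[OF closed_in_Diff[OF assms(2)]]
      by (auto simp: tight_comps_def)
  qed
  finally show ?thesis .
qed

text \<open>Connectedness ties every tight component of \<open>H - {u, v}\<close> to
  \<open>v\<close>, which has at most \<Delta> - 1 neighbours besides \<open>u\<close>. By
  \<open>many\<close> equality holds: there are \<Delta> - 1 components with one edge each, and
  together with \<open>{u}\<close> they form a join at \<open>v\<close>.\<close>

lemma leaf_join_tight:
  assumes "finite H" "u \<in> H" "nb H u = {v}"
    and conn: "\<And>C. closed_in H C \<Longrightarrow> C \<noteq> {} \<Longrightarrow> C = H"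
    and many: "\<Delta> - 1 \<le> card (tight_comps (H - {u, v}))"
  shows "tight H" "card (tight_comps (H - {u, v})) = \<Delta> - 1"
proof -
  let ?K = "H - {u, v}" and ?T = "tight_comps (H - {u, v})"
  have uv: "(u, v) \<in> parcs G" "v \<in> H" using assms(3) by (auto simp: nb_def)
  then have "u \<noteq> v" using arc_irrefl by auto
  have finT: "finite ?T" using assms(1) by (simp add: finite_tight_comps)
  have Tsub: "A \<subseteq> ?K" if "A \<in> ?T" for A using that by (simp add: tight_comps_def closed_in_def)
  \<comment> \<open>A component without a neighbour of \<open>v\<close> would be closed in
    \<open>H\<close>, since \<open>u\<close> is adjacent to \<open>v\<close> only.\<close>
  have att: "nb A v \<noteq> {}" if A: "A \<in> ?T" for A
  proof
    assume none: "nb A v = {}"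
    have "closed_in H A"
      unfolding closed_in_def
    proof (intro conjI ballI subsetI)
      show "x \<in> H" if "x \<in> A" for x using Tsub[OF A] that by auto
      fix x y assume x: "x \<in> A" and y: "y \<in> nb H x"
      have "y \<noteq> v" using none x y arc_sym by (auto simp: nb_def)
      moreover have "y \<noteq> u"
      proof
        assume "y = u"
        then have "x \<in> nb H u" using x y Tsub[OF A] arc_sym by (auto simp: nb_def)
        then show False using assms(3) x Tsub[OF A] by auto
      qed
      ultimately have "y \<in> nb ?K x" using y by (simp add: nb_def)
      then show "y \<in> A" using A x by (auto simp: tight_comps_def closed_in_def)
    qed
    moreover have "A \<noteq> {}" using A tight_nonempty by (auto simp: tight_comps_def)
    ultimately have "A = H" by (rule conn)
    then show False using Tsub[OF A] assms(2) by auto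
  qed
  have "(\<Sum>A\<in>?T. card (nb A v)) = card (\<Union>A\<in>?T. nb A v)"
  proof (rule card_UN_disjoint[symmetric])
    show "\<forall>A\<in>?T. \<forall>B\<in>?T. A \<noteq> B \<longrightarrow> nb A v \<inter> nb B v = {}"
      using tight_comps_disjoint nb_subset by blast
  qed (auto simp: finT finite_nb)
  also have "\<dots> \<le> card (nb H v - {u})"
    using Tsub by (intro card_mono finite_Diff finite_nb) (auto simp: nb_def)
  also have "\<dots> = card (nb H v) - 1"
    using uv assms(2) arc_sym by (subst card_Diff_singleton) (auto simp: nb_def)
  also have "\<dots> \<le> \<Delta> - 1" using card_nb_le[of H v] by simp
  finally have sum: "(\<Sum>A\<in>?T. card (nb A v)) \<le> \<Delta> - 1" .
  have ge1: "1 \<le> card (nb A v)" if "A \<in> ?T" for A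
    using att[OF that] finite_nb by (simp add: Suc_le_eq card_gt_0_iff)
  have "card ?T \<le> (\<Sum>A\<in>?T. card (nb A v))"
    using sum_mono[of ?T "\<lambda>_. 1" "\<lambda>A. card (nb A v)"] ge1 by simp
  then show cT: "card ?T = \<Delta> - 1" using sum many by simp
  have one: "card (nb A v) = 1" if A: "A \<in> ?T" for A
  proof (rule ccontr)
    assume "card (nb A v) \<noteq> 1"
    then have "1 < card (nb A v)" using ge1[OF A] by simp
    then have "(\<Sum>A\<in>?T. 1) < (\<Sum>A\<in>?T. card (nb A v))"
      using finT ge1 A by (intro sum_strict_mono_ex1) auto
    then show False using sum cT by simp
  qed
  \<comment> \<open>The leaf \<open>u\<close> supplies the \<Delta>-th member.\<close>
  let ?F = "insert {u} ?T"
  have UF: "\<Union>?F \<subseteq> H - {v}" using Tsub assms(2) \<open>u \<noteq> v\<close> by auto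
  have clF: "closed_in (\<Union>?F) A" if A: "A \<in> ?F" for A
  proof (cases "A = {u}")
    case True
    have "nb (\<Union>?F) u \<subseteq> {v} \<inter> (H - {v})"
      using UF assms(3) unfolding nb_def by blast
    then show ?thesis using True by (auto simp: closed_in_def)
  next
    case False
    then have A: "A \<in> ?T" using A by simp
    have "y \<in> A" if x: "x \<in> A" and y: "y \<in> nb (\<Union>?F) x" for x y
    proof -
      have "y \<noteq> u"
      proof
        assume "y = u"
        then have "x \<in> nb H u" using x y Tsub[OF A] arc_sym by (auto simp: nb_def)
        then show False using assms(3) x Tsub[OF A] by auto
      qed
      then have "y \<in> nb ?K x" using y UF by (auto simp: nb_def)
      then show ?thesis using A x by (auto simp: tight_comps_def closed_in_def)
    qed
    then show ?thesis using A by (auto simp: closed_in_def)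
  qed
  have tightC: "tight (insert v (\<Union>?F))"
  proof (rule tight.join)
    have "{u} \<notin> ?T" using Tsub by auto
    then show "card ?F = \<Delta>" using cT finT four_le by simp
    show "\<forall>A\<in>?F. tight A" by (auto simp: tight_comps_def tight.single)
    show "\<forall>A\<in>?F. closed_in (\<Union>?F) A" using clF by blast
    have "nb {u} v = {u}" using arc_sym[OF uv(1)] by (auto simp: nb_def)
    then show "\<forall>A\<in>?F. card (nb A v) = 1" using one by auto
    show "v \<notin> \<Union>?F" using UF by auto
  qed
  let ?C = "insert v (\<Union>?F)"
  \<comment> \<open>The \<Delta> - 1 neighbours of \<open>v\<close> in tight components exhaust
    those other than \<open>u\<close>, so the join is closed in \<open>H\<close> and fills
    it.\<close>
  have "nb ?K v \<subseteq> \<Union>?T"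
  proof -
    have "card (nb ?K v) \<le> card (nb H v - {u})"
      by (intro card_mono finite_Diff finite_nb) (auto simp: nb_def)
    also have "\<dots> = card (nb H v) - 1"
      using uv assms(2) arc_sym by (subst card_Diff_singleton) (auto simp: nb_def)
    also have "\<dots> \<le> card (\<Union>A\<in>?T. nb A v)"
      using card_nb_le[of H v] cT \<open>card ?T \<le> (\<Sum>A\<in>?T. card (nb A v))\<close>
        \<open>(\<Sum>A\<in>?T. card (nb A v)) = card (\<Union>A\<in>?T. nb A v)\<close> by simp
    finally have "(\<Union>A\<in>?T. nb A v) = nb ?K v"
      using Tsub by (intro card_seteq finite_nb) (auto simp: nb_def)
    then show ?thesis using nb_subset by blast
  qed
  have "closed_in H ?C"
    unfolding closed_in_def
  proof (intro conjI ballI subsetI)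
    show "x \<in> H" if "x \<in> ?C" for x using that UF uv(2) by auto
    fix x y assume x: "x \<in> ?C" and y: "y \<in> nb H x"
    show "y \<in> ?C"
    proof (cases "y = u \<or> y = v")
      case True then show ?thesis by auto
    next
      case False
      then have yK: "y \<in> nb ?K x" using y by (simp add: nb_def)
      consider "x = v" | "x = u" | A where "A \<in> ?T" "x \<in> A" using x by auto
      then show ?thesis
      proof cases
        case 1 then show ?thesis using yK \<open>nb ?K v \<subseteq> \<Union>?T\<close> by auto
      next
        case 2 then show ?thesis using y assms(3) by auto
      next
        case 3
        then have "y \<in> A" using yK by (auto simp: tight_comps_def closed_in_def)
        then show ?thesis using 3(1) by auto
      qed
    qed
  qed
  then have "?C = H" using conn by blast
  then show "tight H" using tightC by simp
qed

section \<open>The minimal counterexample\<close>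

theorem deficiency_le_card_tight_comps:
  "finite H \<Longrightarrow> deficiency H \<le> int (card (tight_comps H))"
proof (induction "card H" arbitrary: H rule: less_induct)
  case (less H)
  note fin = \<open>finite H\<close>
  have IH: "deficiency X \<le> int (card (tight_comps X))" if "X \<subset> H" for X
    using less that by (meson finite_subset psubset_card_mono psubset_imp_subset)
  show ?case
  proof (rule ccontr)
    assume "\<not> ?thesis"
    then have big: "int (card (tight_comps H)) + 1 \<le> deficiency H" by simp
    have "deficiency {} \<le> 0" by (simp add: deficiency_def)
    then have "H \<noteq> {}" using big by auto
    \<comment> \<open>In a proper split both parts obey the bound; deficiency is subadditive, and
      tight components of the parts are tight components of \<open>H\<close>.\<close>
    have conn: "C = H" if C: "closed_in H C" "C \<noteq> {}" for C
    proof (rule ccontr)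
      assume "C \<noteq> H"
      then have "C \<subset> H" "H - C \<subset> H" using C by (auto simp: closed_in_def)
      then show False
        using IH[of C] IH[of "H - C"] deficiency_closed_in[OF fin C(1)]
          card_tight_comps_closed_in[OF fin C(1)] big by linarith
    qed
    \<comment> \<open>The violation of the bound by at least 1 makes up for the deleted vertex
      \<open>u\<close> itself. The subtraction does not truncate, as degrees are at most
      \<Delta>.\<close>
    have step: "\<Delta> - card (nb H u) + card (tight_comps H) \<le> card (tight_comps (rest H u))"
      if u: "u \<in> H" "nb H u \<noteq> {}" for u
    proof -
      have "rest H u \<subset> H" using u by auto
      then show ?thesis
        using IH[of "rest H u"] deficiency_rest[OF fin u] big card_nb_le[of H u] by linarith
    qed
    have deg1: "nb H z \<noteq> {}" if z: "z \<in> H" for z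
    proof
      assume "nb H z = {}"
      then have "closed_in H {z}" using z by (auto simp: closed_in_def)
      then have H: "H = {z}" using conn by blast
      have "{z} \<in> tight_comps H"
        using H \<open>nb H z = {}\<close> by (auto simp: tight_comps_def closed_in_def tight.single)
      then have "1 \<le> card (tight_comps H)"
        using finite_tight_comps[OF fin] by (metis One_nat_def Suc_le_eq card_gt_0_iff empty_iff)
      moreover have "deficiency H \<le> 1" using H by (simp add: deficiency_def)
      ultimately show False using big by simp
    qed
    have deg2: "2 \<le> card (nb H u)" if u: "u \<in> H" for u
    proof (rule ccontr)
      assume "\<not> ?thesis"
      moreover have "card (nb H u) \<noteq> 0" using deg1[OF u] finite_nb by simp
      ultimately have c1: "card (nb H u) = 1" by simp
      then obtain v where v: "nb H u = {v}" by (rule card_1_singletonE)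
      have st: "\<Delta> - 1 + card (tight_comps H) \<le> card (tight_comps (H - {u, v}))"
        using step[OF u deg1[OF u]] c1 v by simp
      then have "\<Delta> - 1 \<le> card (tight_comps (H - {u, v}))" by simp
      note lj = leaf_join_tight[OF fin u v conn this]
      \<comment> \<open>Being tight, \<open>H\<close> adds 1 to the left side of \<open>st\<close>,
        whose right side is exactly \<Delta> - 1.\<close>
      have "H \<in> tight_comps H" using lj(1) by (auto simp: tight_comps_def closed_in_def nb_def)
      then have "card (tight_comps H) > 0"
        using finite_tight_comps[OF fin] by (auto simp: card_gt_0_iff)
      then show False using st lj(2) by simp
    qed
    have deg: "\<Delta> - 1 \<le> card (nb H u)" if u: "u \<in> H" for u
    proof (rule ccontr)
      assume less: "\<not> ?thesis"
      then have "0 < card (tight_comps (rest H u))" using step[OF u deg1[OF u]] by simp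
      then have "tight_comps (rest H u) \<noteq> {}" by auto
      then show False using card_nb_ge_if_tight_comp[of H u] deg2 less by blast
    qed
    \<comment> \<open>Deficiency at least 0 rather than positive, since the deletion at
      \<open>w\<close> below may use up the surplus of \<open>H\<close>.\<close>
    define P where "P X \<longleftrightarrow> X \<subseteq> H \<and> X \<noteq> {} \<and> 0 \<le> deficiency X \<and> (\<forall>y\<in>X. \<Delta> - 1 \<le> card (nb X y))" for X
    have "P H" using deg big \<open>H \<noteq> {}\<close> by (simp add: P_def)
    then obtain X where X: "P X" and minX: "\<And>Y. card Y < card X \<Longrightarrow> \<not> P Y"
      using exists_least_iff[of "\<lambda>n. \<exists>Y. P Y \<and> card Y = n"] by metis
    have XH: "X \<subseteq> H" "X \<noteq> {}" "0 \<le> deficiency X" and degX: "\<And>y. y \<in> X \<Longrightarrow> \<Delta> - 1 \<le> card (nb X y)"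
      using X by (auto simp: P_def)
    have finX: "finite X" using XH(1) fin finite_subset by blast
    \<comment> \<open>Deleting around such a \<open>w\<close> keeps the deficiency nonnegative. In
      \<open>H\<close> itself the surplus 1 pays for a vertex of degree \<Delta>; in a proper
      subset, connectedness of \<open>H\<close> gives a vertex with a neighbour outside
      \<open>X\<close>, hence of degree at most \<Delta> - 1 in \<open>X\<close>.\<close>
    have "\<exists>w\<in>X. int (card (nb X w)) + 1 \<le> deficiency X + int \<Delta>"
    proof (cases "X = H")
      case True
      obtain w where "w \<in> X" using XH(2) by blast
      moreover have "int (card (nb X w)) + 1 \<le> deficiency X + int \<Delta>"
        unfolding True using big card_nb_le[of H w] by linarith
      ultimately show ?thesis by blast
    next
      case False
      then have "\<not> closed_in H X" using conn XH(2) by blast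
      then obtain w y where w: "w \<in> X" "y \<in> nb H w" "y \<notin> X"
        using XH(1) by (auto simp: closed_in_def)
      then have "nb X w \<subset> nb H w" using XH(1) by (auto simp: nb_def)
      then have "card (nb X w) < card (nb H w)" by (simp add: psubset_card_mono finite_nb)
      then have "int (card (nb X w)) + 1 \<le> int \<Delta>" using card_nb_le[of H w] by linarith
      then show ?thesis using w(1) XH(3) by force
    qed
    then obtain w where w: "w \<in> X" "int (card (nb X w)) + 1 \<le> deficiency X + int \<Delta>" by blast
    have nbw: "nb X w \<noteq> {}" using degX[OF w(1)] four_le by auto
    let ?Y = "rest X w"
    have defY: "0 \<le> deficiency ?Y" using deficiency_rest[OF finX w(1) nbw] w(2) by linarith
    have degY: "\<Delta> - 2 \<le> card (nb ?Y y)" if "y \<in> ?Y" for y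
      using card_nb_rest[OF that] degX[of y] that by auto
    \<comment> \<open>Otherwise a neighbour \<open>y\<close> of \<open>w\<close> has all its
      neighbours in the closed neighbourhood of \<open>w\<close>; without triangles only
      \<open>w\<close> remains.\<close>
    have "?Y \<noteq> {}"
    proof
      assume Y: "?Y = {}"
      obtain y where y: "y \<in> nb X w" using nbw by blast
      have "nb X y \<subseteq> {w}"
      proof
        fix x assume x: "x \<in> nb X y"
        have "x \<notin> nb X w" using x y triangle_free[of w y x] arc_sym by (auto simp: nb_def)
        then show "x \<in> {w}" using Y x by (auto simp: nb_def)
      qed
      then have "card (nb X y) \<le> 1" using card_mono[of "{w}" "nb X y"] by simp
      then show False using degX[of y] y nb_subset[of X w] four_le by auto
    qed
    have finY: "finite ?Y" using finX by simp
    have "?Y \<subset> X" using w(1) by auto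
    \<comment> \<open>The smaller set is nonempty and of nonnegative deficiency, so it must fail the
      degree condition.\<close>
    then have "\<not> P ?Y" using minX finX psubset_card_mono by blast
    then obtain x where x: "x \<in> ?Y" "card (nb ?Y x) < \<Delta> - 1"
      using XH(1) \<open>?Y \<noteq> {}\<close> defY by (auto simp: P_def not_le)
    have "nb ?Y x \<noteq> {}" using degY[OF x(1)] four_le by auto
    \<comment> \<open>At most \<Delta> - 1 vertices go while \<open>nu\<close> drops by at least
      one, so the deficiency rises by at least 1.\<close>
    then have "1 \<le> deficiency (rest ?Y x)"
      using deficiency_rest[OF finY x(1)] defY x(2) by linarith
    moreover have "rest ?Y x \<subset> H" using x(1) XH(1) by auto
    ultimately have "tight_comps (rest ?Y x) \<noteq> {}" using IH[of "rest ?Y x"] by auto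
    \<comment> \<open>Here \<open>4 \<le> \<Delta>\<close> turns the degree bound \<Delta> - 2 into
      2.\<close>
    moreover have "2 \<le> card (nb ?Y y)" if "y \<in> rest ?Y x" for y
      using degY[of y] that four_le by auto
    ultimately show False using card_nb_ge_if_tight_comp[of ?Y x] x(2) by auto
  qed
qed

section \<open>From tight components to connected components\<close>

lemma card_tight_comps_le_num_components: "card (tight_comps (pverts G)) \<le> num_components G"
proof -
  \<comment> \<open>Each tight component is sent to the strong component of a chosen vertex. Arcs
    never leave a closed set, so equal images force two tight components to meet.\<close>
  define r where "r C = scc_of (SOME x. x \<in> C)" for C
  have some: "(SOME x. x \<in> C) \<in> C" if "C \<in> tight_comps (pverts G)" for C
    using that tight_nonempty by (auto simp: tight_comps_def some_in_eq)
  have sub: "C \<subseteq> pverts G" if "C \<in> tight_comps (pverts G)" for C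
    using that by (auto simp: tight_comps_def closed_in_def)
  have reach: "y \<in> C" if "x \<rightarrow>\<^sup>*\<^bsub>with_proj G\<^esub> y" "x \<in> C" "C \<in> tight_comps (pverts G)" for x y C
    using that(1,2)
  proof (induction rule: reachable_induct)
    case (step x' y')
    then have "y' \<in> nb (pverts G) x'" by (auto simp: nb_def dest: in_arcsD2)
    then show ?case using step that(3) by (auto simp: tight_comps_def closed_in_def)
  qed
  have "inj_on r (tight_comps (pverts G))"
  proof (rule inj_onI)
    fix A B assume AB: "A \<in> tight_comps (pverts G)" "B \<in> tight_comps (pverts G)" "r A = r B"
    let ?a = "SOME x. x \<in> A" and ?b = "SOME x. x \<in> B"
    have "?a \<in> scc_of ?a" using some[OF AB(1)] sub[OF AB(1)] by (intro in_scc_of_self) auto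
    then have "?a \<in> scc_of ?b" using AB(3) by (simp add: r_def)
    then have "?b \<rightarrow>\<^sup>*\<^bsub>with_proj G\<^esub> ?a" by (simp add: scc_of_def)
    then have "?a \<in> B" using reach some[OF AB(2)] AB(2) by blast
    then show "A = B" using tight_comps_disjoint[OF AB(1,2)] some[OF AB(1)] by blast
  qed
  moreover have "r ` tight_comps (pverts G) \<subseteq> sccs_verts"
    using some sub by (auto simp: r_def intro!: scc_of_in_sccs_verts)
  ultimately have "card (tight_comps (pverts G)) \<le> card sccs_verts"
    using finite_sccs_verts by (intro card_inj_on_le[of r])
  then show ?thesis by (simp add: num_components_def card_sccs_verts)
qed

end

theorem theorem3:
  fixes G :: "'a pair_pre_digraph" and \<Delta> :: nat
  assumes "4 \<le> \<Delta>"
    and "pair_graph G"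
    and "max_degree G \<le> \<Delta>"
    and "5 \<le> girth G"
  shows "real (nu_ur G) \<ge> (real (card (pverts G)) - real (num_components G)) / real \<Delta>"
proof -
  interpret girth_five_graph G \<Delta>
    using assms by (simp add: girth_five_graph_def girth_five_graph_axioms_def)
  have "int (card (pverts G)) \<le> int \<Delta> * int (nu (pverts G)) + int (num_components G)"
    using deficiency_le_card_tight_comps[OF pair_finite_verts] card_tight_comps_le_num_components
    by (simp add: deficiency_def)
  then have "card (pverts G) \<le> \<Delta> * nu (pverts G) + num_components G"
    by (metis of_nat_add of_nat_le_iff of_nat_mult)
  also have "\<dots> \<le> \<Delta> * nu_ur G + num_components G"
    using nu_le_nu_ur by simp
  finally have "real (card (pverts G)) \<le> real \<Delta> * real (nu_ur G) + real (num_components G)"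
    by (metis of_nat_add of_nat_le_iff of_nat_mult)
  then show ?thesis using assms(1) by (simp add: divide_le_eq algebra_simps)
qed

end
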